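(* Let $E,A\in\mathbb{R}^{n\times n}$, $B\in\mathbb{R}^{n\times m}$, $C\in\mathbb{R}^{m\times n}$, and suppose that the descriptor system $E\dot x=Ax+Bu,\ y=Cx$ admits a pH representation. Suppose that at least one of the following two problems is solvable. (P1) There exists $K\in\mathbb{R}^{m\times m}$ such that the pair $(E,A-BKC)$ is regular, impulse-free and asymptotically stable, and the closed-loop system $E\dot x=(A-BKC)x+Bv,\ y=Cx$ admits a pH representation. (P2) For a prescribed integer $r$, there exist $K,F\in\mathbb{R}^{m\times m}$ such that the pair $(E+BFC,A-BKC)$ is regular, impulse-free and asymptotically stable, $\operatorname{rank}(E+BFC)=r$, and the closed-loop system $(E+BFC)\dot x=(A-BKC)x+Bv,\ y=Cx$ admits a pH representation. Then: (i) for every pH representation $(J,R,Q,G,P)$ of the system $E\dot x=Ax+Bu,\ y=Cx$, the matrix $Q$ is nonsingular; (ii) for every pH representation $(J,R,Q,G,P)$ of the system, the relation $Q^TP=0$ implies $P=0$ (so $P=0$); (iii) for every pH representation $(J,R,Q,G,P)$ of the system, the system $E\dot x=Ax+Bu,\ y=Cx$ is equivalent to the pH descriptor system $$(Q^TE)\dot x=(Q^TJQ-Q^TRQ)x+(Q^TG)u,\qquad y=(Q^TG)^Tx,$$ where $Q^TE\ge 0$, $(Q^TJQ)^T=-(Q^TJQ)$ and $Q^TRQ\ge 0$.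
   Context: All matrices are real. $M\ge 0$ means $M$ is symmetric positive semidefinite. A pH (port-Hamiltonian) representation of the descriptor system $E\dot x=Ax+Bu,\ y=Cx$ (with $E,A\in\mathbb{R}^{n\times n}$, $B\in\mathbb{R}^{n\times m}$, $C\in\mathbb{R}^{m\times n}$) is a tuple of matrices $J,R,Q\in\mathbb{R}^{n\times n}$, $G,P\in\mathbb{R}^{n\times m}$ with $$A=(J-R)Q,\quad B=G-P,\quad C=(G+P)^TQ,$$ $$Q^TE=E^TQ\ge 0,\quad Q^TJQ=-(Q^TJQ)^T,\quad Q^TRQ\ge 0,\quad Q^TP=0.$$ A system is a pH descriptor system (admits a pH representation) if at least one such tuple exists. For a closed-loop system, the definition is applied to its own coefficient matrices. A pair $(E,A)$ is regular if $\det(sE-A)\ne0$ for some $s\in\mathbb{C}$; regular and impulse-free if $\deg(\det(sE-A))=\operatorname{rank}(E)$ (the zero polynomial having degree $-\infty$); regular and asymptotically stable if all roots $s\in\mathbb C$ of $\det(sE-A)=0$ have strictly negative real part. Equivalence of systems in (iii) is meant with the same $x,u,y$: the second system is obtained from the first by left-multiplying the state equation by the nonsingular matrix $Q^T$ (so $Q^TA=Q^TJQ-Q^TRQ$, $Q^TB=Q^TG$, $C=(Q^TG)^T$). *)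

theory Defs
  imports "HOL-Analysis.Analysis" "HOL-Computational_Algebra.Polynomial"
begin

definition psd :: "real^'n^'n \<Rightarrow> bool" where
  "psd M \<longleftrightarrow> transpose M = M \<and> (\<forall>x. 0 \<le> x \<bullet> (M *v x))"

(* A descriptor system E x' = A x + B u, y = C x is given by its coefficients (E, A, B, C),
   with states in R^n and with inputs and outputs in R^m. *)
type_synonym ('n, 'm) descriptor_system =
  "(real^'n^'n) \<times> (real^'n^'n) \<times> (real^'m^'n) \<times> (real^'n^'m)"

fun is_pH_representation ::
  "('n::finite, 'm::finite) descriptor_system \<Rightarrow>
   real^'n^'n \<Rightarrow> real^'n^'n \<Rightarrow> real^'n^'n \<Rightarrow> real^'m^'n \<Rightarrow> real^'m^'n \<Rightarrow> bool" where
  "is_pH_representation (E, A, B, C) J R Q G P \<longleftrightarrow>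
     A = (J - R) ** Q \<and>
     B = G - P \<and>
     C = transpose (G + P) ** Q \<and>
     transpose Q ** E = transpose E ** Q \<and>
     psd (transpose Q ** E) \<and>
     transpose Q ** J ** Q = - transpose (transpose Q ** J ** Q) \<and>
     psd (transpose Q ** R ** Q) \<and>
     transpose Q ** P = 0"

definition pH_system :: "('n::finite, 'm::finite) descriptor_system \<Rightarrow> bool" where
  "pH_system S \<longleftrightarrow> (\<exists>J R Q G P. is_pH_representation S J R Q G P)"

definition pencil :: "real^'n^'n \<Rightarrow> real^'n^'n \<Rightarrow> complex \<Rightarrow> complex^'n^'n" where
  "pencil E A s = (\<chi> i j. s * of_real (E $ i $ j) - of_real (A $ i $ j))"

(* det (s E - A) as a formal polynomial in s; the entry s E_ij - A_ij is [:- A_ij, E_ij:]. *)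
definition pencil_poly :: "real^'n^'n \<Rightarrow> real^'n^'n \<Rightarrow> complex poly" where
  "pencil_poly E A = det (\<chi> i j. [:- of_real (A $ i $ j), of_real (E $ i $ j):])"

lemma poly_pencil_poly: "poly (pencil_poly E A) s = det (pencil E A s)"
  by (simp add: pencil_poly_def pencil_def det_def poly_sum poly_prod algebra_simps)

definition regular :: "real^'n^'n \<Rightarrow> real^'n^'n \<Rightarrow> bool" where
  "regular E A \<longleftrightarrow> (\<exists>s. det (pencil E A s) \<noteq> 0)"

(* Since degree 0 = 0 in the library, the convention that the zero polynomial has degree
   minus infinity becomes the first conjunct. *)
definition regular_impulse_free :: "real^'n^'n \<Rightarrow> real^'n^'n \<Rightarrow> bool" where
  "regular_impulse_free E A \<longleftrightarrow>
     pencil_poly E A \<noteq> 0 \<and> degree (pencil_poly E A) = rank E"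

(* Regularity is implied: if det (s E - A) vanished identically, s = 0 would be a root. *)
definition regular_asymp_stable :: "real^'n^'n \<Rightarrow> real^'n^'n \<Rightarrow> bool" where
  "regular_asymp_stable E A \<longleftrightarrow> (\<forall>s. det (pencil E A s) = 0 \<longrightarrow> Re s < 0)"

definition admissible :: "real^'n^'n \<Rightarrow> real^'n^'n \<Rightarrow> bool" where
  "admissible E A \<longleftrightarrow>
     regular E A \<and> regular_impulse_free E A \<and> regular_asymp_stable E A"

fun solvable_P1 :: "('n::finite, 'm::finite) descriptor_system \<Rightarrow> bool" where
  "solvable_P1 (E, A, B, C) \<longleftrightarrow>
     (\<exists>K. admissible E (A - B ** K ** C) \<and> pH_system (E, A - B ** K ** C, B, C))"

fun solvable_P2 :: "('n::finite, 'm::finite) descriptor_system \<Rightarrow> int \<Rightarrow> bool" where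
  "solvable_P2 (E, A, B, C) r \<longleftrightarrow>
     (\<exists>K F. admissible (E + B ** F ** C) (A - B ** K ** C) \<and>
        int (rank (E + B ** F ** C)) = r \<and>
        pH_system (E + B ** F ** C, A - B ** K ** C, B, C))"

(* Equivalence with the same x, u and y: the second system arises from the first by
   multiplying the state equation from the left by the nonsingular matrix T. *)
fun equivalent_via ::
  "real^'n^'n \<Rightarrow> ('n::finite, 'm::finite) descriptor_system \<Rightarrow>
   ('n, 'm) descriptor_system \<Rightarrow> bool" where
  "equivalent_via T (E, A, B, C) (E', A', B', C') \<longleftrightarrow>
     invertible T \<and> E' = T ** E \<and> A' = T ** A \<and> B' = T ** B \<and> C' = C"

end

theory Submission
  imports Defs
begin

text \<open>
  Asymptotic stability excludes the root \<open>s = 0\<close>, so the state matrix of the closed loop is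
  nonsingular. Both \<open>A = (J - R) Q\<close> and \<open>C = (G + P)\<^sup>T Q\<close> have the right factor \<open>Q\<close>, hence so does
  every \<open>A - B K C\<close>, and \<open>det Q\<close> divides its determinant.
\<close>

lemma det_pencil_0: "det (pencil E A 0) = of_real (det (- A))"
  by (simp add: pencil_def det_def)

lemma regular_asymp_stable_imp_invertible:
  assumes "regular_asymp_stable E A"
  shows "invertible A"
proof -
  have "det (- A) \<noteq> 0"
    using assms det_pencil_0[of E A] unfolding regular_asymp_stable_def
    by (metis less_irrefl of_real_0 zero_complex.simps(1))
  then have "invertible (- A)"
    by (simp add: invertible_det_nz)
  \<comment> \<open>Negating the inverse of \<open>- A\<close> inverts \<open>A\<close>, which
    avoids computing the sign in \<open>det (- A)\<close>.\<close>
  then obtain X where "- A ** X = mat 1" "X ** - A = mat 1"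
    unfolding invertible_def by blast
  then have "A ** - X = mat 1" "- X ** A = mat 1"
    by (simp_all add: matrix_matrix_mult_def vec_eq_iff sum_negf)
  then show ?thesis
    unfolding invertible_def by blast
qed

lemma matrix_diff_rdistrib:
  fixes A B :: "'a::ring_1^'n^'m"
  shows "(A - B) ** C = A ** C - B ** C"
  by (simp add: matrix_matrix_mult_def vec_eq_iff sum_subtractf left_diff_distrib)

lemma matrix_diff_ldistrib:
  fixes B C :: "'a::ring_1^'n^'m"
  shows "A ** (B - C) = A ** B - A ** C"
  by (simp add: matrix_matrix_mult_def vec_eq_iff sum_subtractf right_diff_distrib)

text \<open>Output feedback preserves the right factor \<open>Q\<close>, since \<open>C\<close>
  carries it too. Leaving \<open>E'\<close> free lets one statement serve both problems, whether or
  not the feedback also changes \<open>E\<close>.\<close>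

lemma pH_representation_invertible_Q:
  assumes rep: "is_pH_representation (E, A, B, C) J R Q G P"
    and stable: "regular_asymp_stable E' (A - B ** K ** C)"
  shows "invertible Q"
proof -
  have "A - B ** K ** C = (J - R - B ** K ** transpose (G + P)) ** Q"
    using rep by (simp add: matrix_diff_rdistrib matrix_mul_assoc)
  then have "det (J - R - B ** K ** transpose (G + P)) * det Q \<noteq> 0"
    using regular_asymp_stable_imp_invertible[OF stable] by (metis det_mul invertible_det_nz)
  then show ?thesis
    by (simp add: invertible_det_nz)
qed

text \<open>\<open>transpose Q\<close> is invertible along with \<open>Q\<close>, so a left inverse
  cancels it from \<open>transpose Q ** P = 0\<close>.\<close>

lemma pH_representation_invertible_Q_imp_P_eq_0:
  assumes rep: "is_pH_representation (E, A, B, C) J R Q G P"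
    and Q: "invertible Q"
  shows "P = 0"
proof -
  obtain X where "X ** transpose Q = mat 1"
    using transpose_invertible[OF Q] unfolding invertible_def by blast
  then have "P = X ** (transpose Q ** P)"
    by (simp add: matrix_mul_assoc)
  also have "\<dots> = X ** 0"
    using rep by simp
  also have "\<dots> = 0"
    by (simp add: matrix_matrix_mult_def vec_eq_iff)
  finally show ?thesis .
qed

text \<open>The choice \<open>Q = mat 1\<close>, \<open>P = 0\<close> is a representation. It shows
  that the transformed system is again pH, with \<open>transpose Q ** J ** Q\<close> and
  \<open>transpose Q ** R ** Q\<close> in the roles of \<open>J\<close> and
  \<open>R\<close>.\<close>

lemma pH_system_identity_Q:
  fixes E J R :: "real^'n^'n" and G :: "real^'m^'n"
  assumes "psd E" "transpose J = - J" "psd R"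
  shows "pH_system (E, J - R, G, transpose G)"
proof -
  \<comment> \<open>This is the orientation in which the definition of a representation states
    skew-symmetry.\<close>
  have "J = - transpose J"
    using assms(2) by simp
  then have "is_pH_representation (E, J - R, G, transpose G) J R (mat 1) G 0"
    using assms by (simp add: psd_def)
  then show ?thesis
    unfolding pH_system_def by blast
qed

text \<open>Once \<open>P = 0\<close>, the representation reduces to \<open>B = G\<close> and
  \<open>C = transpose G ** Q\<close>, and the latter is
  \<open>transpose (transpose Q ** G)\<close>.\<close>

lemma pH_representation_equivalent:
  assumes rep: "is_pH_representation (E, A, B, C) J R Q G P"
    and Q: "invertible Q"
  shows "equivalent_via (transpose Q) (E, A, B, C)
    (transpose Q ** E, transpose Q ** J ** Q - transpose Q ** R ** Q,
     transpose Q ** G, transpose (transpose Q ** G))"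
  using rep transpose_invertible[OF Q] pH_representation_invertible_Q_imp_P_eq_0[OF assms]
  by (simp add: matrix_mul_assoc matrix_diff_ldistrib matrix_diff_rdistrib matrix_transpose_mul)

theorem proposition2p1:
  fixes E A :: "real^'n^'n" and B :: "real^'m^'n" and C :: "real^'n^'m" and r :: int
  assumes "pH_system (E, A, B, C)"
    and "solvable_P1 (E, A, B, C) \<or> solvable_P2 (E, A, B, C) r"
  shows
    "(\<forall>J R Q G P. is_pH_representation (E, A, B, C) J R Q G P \<longrightarrow> invertible Q) \<and>
     (\<forall>J R Q G P. is_pH_representation (E, A, B, C) J R Q G P \<longrightarrow>
        (transpose Q ** P = 0 \<longrightarrow> P = 0) \<and> P = 0) \<and>
     (\<forall>J R Q G P. is_pH_representation (E, A, B, C) J R Q G P \<longrightarrow>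
        (let S' = (transpose Q ** E,
                   transpose Q ** J ** Q - transpose Q ** R ** Q,
                   transpose Q ** G,
                   transpose (transpose Q ** G))
         in equivalent_via (transpose Q) (E, A, B, C) S' \<and>
            pH_system S' \<and>
            psd (transpose Q ** E) \<and>
            transpose (transpose Q ** J ** Q) = - (transpose Q ** J ** Q) \<and>
            psd (transpose Q ** R ** Q)))"
proof -
  \<comment> \<open>Here \<open>E'\<close> is \<open>E\<close> for the first problem and
    \<open>E + B ** F ** C\<close> for the second; the closed-loop state matrix has the same form in
    both.\<close>
  obtain E' K where stable: "regular_asymp_stable E' (A - B ** K ** C)"
    using assms(2) by (auto simp: admissible_def)
  note Q = pH_representation_invertible_Q[OF _ stable]
  have P: "P = 0" if "is_pH_representation (E, A, B, C) J R Q G P" for J R Q G P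
    using pH_representation_invertible_Q_imp_P_eq_0[OF that Q[OF that]] .
  have "equivalent_via (transpose Q) (E, A, B, C)
          (transpose Q ** E, transpose Q ** J ** Q - transpose Q ** R ** Q,
           transpose Q ** G, transpose (transpose Q ** G)) \<and>
        pH_system (transpose Q ** E, transpose Q ** J ** Q - transpose Q ** R ** Q,
           transpose Q ** G, transpose (transpose Q ** G)) \<and>
        psd (transpose Q ** E) \<and>
        transpose (transpose Q ** J ** Q) = - (transpose Q ** J ** Q) \<and>
        psd (transpose Q ** R ** Q)"
    if rep: "is_pH_representation (E, A, B, C) J R Q G P" for J R Q G P
  proof -
    have E: "psd (transpose Q ** E)" and R: "psd (transpose Q ** R ** Q)"
      and "transpose Q ** J ** Q = - transpose (transpose Q ** J ** Q)"
      using rep by auto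
    then have J: "transpose (transpose Q ** J ** Q) = - (transpose Q ** J ** Q)"
      by (metis minus_minus)
    show ?thesis
      using pH_representation_equivalent[OF rep Q[OF rep]] pH_system_identity_Q[OF E J R] E J R
      by blast
  qed
  then show ?thesis
    unfolding Let_def using Q P by blast
qed

end
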